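(* Let $n$ be a positive integer and let $\mathcal B=\left[\frac{1}{\beta(i,j)}\right]_{i,j=1}^{n}$. Then for every real $r>0$ the matrix $\mathcal B^{\circ r}=\left[\frac{1}{\beta(i,j)^r}\right]_{i,j=1}^{n}$ is totally positive.
   Context: Here $\beta(x,y)=\frac{\Gamma(x)\Gamma(y)}{\Gamma(x+y)}$ is the beta function, so $\frac{1}{\beta(i,j)}=\frac{(i+j-1)!}{(i-1)!(j-1)!}$ for positive integers $i,j$. For a matrix $A=[a_{ij}]$ with nonnegative entries, $A^{\circ r}=[a_{ij}^r]$ is the entrywise power. A matrix is called totally positive if all its minors are (strictly) positive. *)

theory Defs
  imports
    "HOL-Analysis.Gamma_Function"
    "Jordan_Normal_Form.Determinant"
    "Jordan_Normal_Form.DL_Submatrix"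
begin

(* Matrix indices start at 0, so the entry at position (i, j) is the mathematical entry
   with indices i + 1 and j + 1. *)
definition beta_mat :: "nat \<Rightarrow> real mat" where
  "beta_mat n = mat n n (\<lambda>(i, j). 1 / Beta (real (i + 1)) (real (j + 1)))"

(* Meant for matrices with nonnegative entries: powr is the usual real power there
   (with 0 powr r = 0). *)
definition hadamard_power :: "real mat \<Rightarrow> real \<Rightarrow> real mat" where
  "hadamard_power A r = map_mat (\<lambda>a. a powr r) A"

definition totally_positive :: "real mat \<Rightarrow> bool" where
  "totally_positive A \<longleftrightarrow>
     (\<forall>I J. I \<subseteq> {..<dim_row A} \<and> J \<subseteq> {..<dim_col A} \<and> I \<noteq> {} \<and> card I = card J
        \<longrightarrow> Determinant.det (submatrix A I J) > 0)"

end

theory Submission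
  imports Defs
begin

text \<open>
  Up to positive factors depending only on the row or only on the column, the entry with indices
  \<open>i\<close> and \<open>j\<close> (counted from zero) of the given power is \<open>Gamma (i + j + 2) powr r\<close>. So it suffices to treat
  minors of an infinite Hankel matrix.

  A Hankel matrix has the advantage that a minor with consecutive rows \<open>a, a + 1, \<dots>\<close> and consecutive
  columns \<open>b, b + 1, \<dots>\<close> is the determinant of the symmetric matrix with entries
  \<open>Gamma (i + j + (a + b + 2)) powr r\<close>. It is positive as soon as this matrix is positive definite. By Fekete's
  criterion (\<open>fekete\<close>) the positivity of all these consecutive minors implies that of all
  minors. The criterion rests on a three-term relation between minors (\<open>minor_three_term\<close>).

  Positive definiteness (\<open>hankel_pd_Gamma_powr\<close>) holds for a reason that is insensitive to the exponent:
  by Gauss's product, \<open>Gamma z\<close> is a limit of products of geometric factors and factors \<open>1 / (z + k)\<close>, and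
  every power \<open>(z + k) powr (- r)\<close> with \<open>r > 0\<close> is a Laplace transform of a positive weight. Entrywise
  multiplication with such a power turns a positive semidefinite Hankel matrix with positive entries
  into a positive definite one (\<open>hankel_pd_powr_mult\<close>).
\<close>

section \<open>Minors and Fekete's criterion\<close>

text \<open>
  Rows and columns are chosen by index functions instead of sets, so that inserting, deleting or
  reordering a row is a composition of functions; only the values below \<open>m\<close> matter.
\<close>

definition minor :: "(nat \<Rightarrow> nat \<Rightarrow> real) \<Rightarrow> (nat \<Rightarrow> nat) \<Rightarrow> (nat \<Rightarrow> nat) \<Rightarrow> nat \<Rightarrow> real" where
  "minor K \<alpha> \<beta> m = Determinant.det (mat m m (\<lambda>(i, j). K (\<alpha> i) (\<beta> j)))"

lemma minor_cong:
  assumes "\<And>i. i < m \<Longrightarrow> \<alpha> i = \<alpha>' i" "\<And>j. j < m \<Longrightarrow> \<beta> j = \<beta>' j"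
  shows "minor K \<alpha> \<beta> m = minor K \<alpha>' \<beta>' m"
  unfolding minor_def by (intro arg_cong[where f = Determinant.det] eq_matI) (auto simp: assms)

lemma minor_transpose: "minor (\<lambda>i j. K j i) \<alpha> \<beta> m = minor K \<beta> \<alpha> m"
proof -
  have "mat m m (\<lambda>(i, j). K (\<beta> j) (\<alpha> i)) = transpose_mat (mat m m (\<lambda>(i, j). K (\<beta> i) (\<alpha> j)))"
    by (intro eq_matI) auto
  then show ?thesis
    unfolding minor_def by (simp add: det_transpose[where n = m])
qed

lemma mat_delete_minor:
  assumes "p \<le> n" "q \<le> n"
  shows "mat_delete (mat (Suc n) (Suc n) (\<lambda>(i, j). K (\<alpha> i) (\<beta> j))) p q
    = mat n n (\<lambda>(i, j). K (\<alpha> (insert_index p i)) (\<beta> (insert_index q j)))"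
  using assms by (intro eq_matI) (auto simp: mat_delete_def insert_index_def)

lemma minor_expand_row:
  assumes "p \<le> n"
  shows "minor K \<alpha> \<beta> (Suc n) =
    (\<Sum>j<Suc n. (-1) ^ (p + j) * K (\<alpha> p) (\<beta> j) * minor K (\<alpha> \<circ> insert_index p) (\<beta> \<circ> insert_index j) n)"
  unfolding minor_def
  by (subst laplace_expansion_row[where i = p and n = "Suc n"])
     (use assms in \<open>auto simp: cofactor_def mat_delete_minor mult_ac less_Suc_eq_le intro!: sum.cong\<close>)

lemma minor_expand_column:
  assumes "q \<le> n"
  shows "minor K \<alpha> \<beta> (Suc n) =
    (\<Sum>i<Suc n. (-1) ^ (i + q) * K (\<alpha> i) (\<beta> q) * minor K (\<alpha> \<circ> insert_index i) (\<beta> \<circ> insert_index q) n)"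
  unfolding minor_def
  by (subst laplace_expansion_column[where j = q and n = "Suc n"])
     (use assms in \<open>auto simp: cofactor_def mat_delete_minor mult_ac less_Suc_eq_le intro!: sum.cong\<close>)

lemma minor_eq_0_if_repeated_column:
  assumes "i < m" "j < m" "i \<noteq> j" "\<beta> i = \<beta> j"
  shows "minor K \<alpha> \<beta> m = 0"
  unfolding minor_def
  by (rule det_identical_columns[where n = m and i = i and j = j]) (use assms in \<open>auto intro!: eq_vecI\<close>)

lemma minor_eq_0_if_repeated_row:
  assumes "i < m" "j < m" "i \<noteq> j" "\<alpha> i = \<alpha> j"
  shows "minor K \<alpha> \<beta> m = 0"
  using minor_eq_0_if_repeated_column[OF assms, of "\<lambda>i j. K j i" \<beta>]
  by (simp only: minor_transpose[of K])

text \<open>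
  Expanding along row \<open>p\<close> of the left-hand matrix and along row \<open>0\<close> of the right-hand one gives the
  same terms, because deleting these rows leaves the same matrix. Keeping track of the position of a
  row in this way replaces any computation of signs of permutations.
\<close>

lemma minor_move_row_to_front:
  assumes "p \<le> n"
  shows "minor K \<alpha> \<beta> (Suc n) = (-1) ^ p * minor K (case_nat (\<alpha> p) (\<alpha> \<circ> insert_index p)) \<beta> (Suc n)"
proof -
  have "case_nat (\<alpha> p) (\<alpha> \<circ> insert_index p) \<circ> insert_index 0 = \<alpha> \<circ> insert_index p"
    by (auto simp: insert_index_def)
  then show ?thesis
    unfolding minor_expand_row[OF assms, of K \<alpha>] minor_expand_row[of 0 n K "case_nat _ _", OF zero_le]
    by (simp add: sum_distrib_left power_add mult.assoc del: sum.lessThan_Suc)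
qed

text \<open>
  A short Pluecker relation. Among the \<open>m + 1\<close> rows \<open>\<gamma> 0, \<dots>, \<gamma> m\<close>, where \<open>m = Suc (Suc q)\<close>, the rows
  \<open>\<gamma> 0\<close>, \<open>\<gamma> s\<close> and \<open>\<gamma> m\<close> are singled out: the minors of order \<open>m\<close> omit one of these three, and the
  minors of order \<open>m - 1\<close> in the first \<open>m - 1\<close> columns omit two. All terms occur with a plus sign, which
  is what makes the relation transport positivity: if the five other minors are positive, so is
  the one that omits the inner row \<open>\<gamma> s\<close>.

  The proof puts one of the \<open>m - 1\<close> first columns twice into a square matrix of order \<open>m + 1\<close>, which
  expresses the vanishing of the alternating combination of the rows with coefficients \<open>D k\<close>. To this
  relation one applies the linear functional \<open>W\<close> that sends a row to its determinant together with the
  \<open>m - 2\<close> rows that are not singled out, all taken in the first \<open>m - 1\<close> columns. It kills those rows,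
  and so three terms remain.
\<close>

lemma minor_three_term:
  assumes s: "0 < s" "s < Suc (Suc q)"
  shows "minor K (\<gamma> \<circ> insert_index s) \<beta> (Suc (Suc q)) * minor K (\<gamma> \<circ> Suc) \<beta> (Suc q)
    = minor K (\<gamma> \<circ> Suc) \<beta> (Suc (Suc q)) * minor K (\<gamma> \<circ> insert_index s) \<beta> (Suc q)
    + minor K \<gamma> \<beta> (Suc (Suc q)) * minor K (\<gamma> \<circ> insert_index s \<circ> Suc) \<beta> (Suc q)"
proof -
  let ?m = "Suc (Suc q)"
  define \<rho> where "\<rho> = \<gamma> \<circ> insert_index s \<circ> Suc"
  define W where "W a = minor K (case_nat a \<rho>) \<beta> (Suc q)" for a
  define D where "D k = minor K (\<gamma> \<circ> insert_index k) \<beta> ?m" for k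
  have W_eq: "W a = (\<Sum>j<Suc q. (-1) ^ j * minor K \<rho> (\<beta> \<circ> insert_index j) q * K a (\<beta> j))" for a
  proof -
    have "case_nat a \<rho> \<circ> insert_index 0 = \<rho>"
      by (auto simp: insert_index_def)
    then show ?thesis
      unfolding W_def by (simp add: minor_expand_row[of 0] mult_ac)
  qed
  \<comment> \<open>Column \<open>j\<close> is repeated as an additional last column, and the determinant is expanded
     along that copy.\<close>
  have rel: "(\<Sum>k<Suc ?m. (-1) ^ k * D k * K (\<gamma> k) (\<beta> j)) = 0" if j: "j < ?m" for j
  proof -
    have "0 = minor K \<gamma> (\<beta>(?m := \<beta> j)) (Suc ?m)"
      by (rule sym, rule minor_eq_0_if_repeated_column[of j _ ?m]) (use j in auto)
    also have "\<dots> = (\<Sum>k<Suc ?m. (-1) ^ (k + ?m) * K (\<gamma> k) (\<beta> j) *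
        minor K (\<gamma> \<circ> insert_index k) (\<beta>(?m := \<beta> j) \<circ> insert_index ?m) ?m)"
      by (subst minor_expand_column[of ?m]) auto
    also have "\<dots> = (\<Sum>k<Suc ?m. (-1) ^ ?m * ((-1) ^ k * D k * K (\<gamma> k) (\<beta> j)))"
    proof (intro sum.cong refl)
      fix k
      have "minor K (\<gamma> \<circ> insert_index k) (\<beta>(?m := \<beta> j) \<circ> insert_index ?m) ?m = D k"
        unfolding D_def by (intro minor_cong) (auto simp: insert_index_def)
      then show "(-1) ^ (k + ?m) * K (\<gamma> k) (\<beta> j) *
          minor K (\<gamma> \<circ> insert_index k) (\<beta>(?m := \<beta> j) \<circ> insert_index ?m) ?m
        = (-1) ^ ?m * ((-1) ^ k * D k * K (\<gamma> k) (\<beta> j))"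
        by (simp add: power_add mult_ac)
    qed
    finally show ?thesis by (simp flip: sum_distrib_left)
  qed
  have "(\<Sum>k<Suc ?m. (-1) ^ k * D k * W (\<gamma> k)) =
      (\<Sum>k<Suc ?m. \<Sum>j<Suc q. ((-1) ^ j * minor K \<rho> (\<beta> \<circ> insert_index j) q) *
        ((-1) ^ k * D k * K (\<gamma> k) (\<beta> j)))"
    unfolding W_eq sum_distrib_left by (intro sum.cong refl) (simp add: mult_ac)
  also have "\<dots> = (\<Sum>j<Suc q. ((-1) ^ j * minor K \<rho> (\<beta> \<circ> insert_index j) q) *
        (\<Sum>k<Suc ?m. (-1) ^ k * D k * K (\<gamma> k) (\<beta> j)))"
    unfolding sum_distrib_left by (rule sum.swap)
  also have "\<dots> = 0"
    by (intro sum.neutral) (simp add: rel del: sum.lessThan_Suc)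
  finally have total: "(\<Sum>k<Suc ?m. (-1) ^ k * D k * W (\<gamma> k)) = 0" .
  have "W (\<gamma> k) = 0" if k: "k < Suc ?m" "k \<notin> {0, s, ?m}" for k
  proof -
    \<comment> \<open>Row \<open>i\<close> of the matrix defining \<open>W (\<gamma> k)\<close> is again \<open>\<gamma> k\<close>.\<close>
    define i where "i = (if k < s then k else k - 1)"
    have i: "0 < i" "i < Suc q" "insert_index s i = k"
      using k s by (auto simp: i_def insert_index_def)
    then have "\<rho> (i - 1) = \<gamma> k" by (simp add: \<rho>_def)
    then show ?thesis
      unfolding W_def using i
      by (intro minor_eq_0_if_repeated_row[of 0 _ i]) (auto split: nat.split)
  qed
  then have "(\<Sum>k<Suc ?m. (-1) ^ k * D k * W (\<gamma> k)) = (\<Sum>k\<in>{0, s, ?m}. (-1) ^ k * D k * W (\<gamma> k))"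
    using s by (intro sum.mono_neutral_right) auto
  then have three: "D 0 * W (\<gamma> 0) + (-1) ^ s * D s * W (\<gamma> s) + (-1) ^ ?m * D ?m * W (\<gamma> ?m) = 0"
    using total s by simp
  have E0: "minor K (\<gamma> \<circ> insert_index s) \<beta> (Suc q) = W (\<gamma> 0)"
    unfolding W_def \<rho>_def using s by (intro minor_cong) (auto simp: insert_index_def split: nat.split)
  have Es: "minor K (\<gamma> \<circ> Suc) \<beta> (Suc q) = (-1) ^ (s - 1) * W (\<gamma> s)"
    using s unfolding W_def \<rho>_def
    by (subst minor_move_row_to_front[of "s - 1"])
       (auto simp: insert_index_def intro!: minor_cong split: nat.split)
  have Em: "minor K (\<gamma> \<circ> insert_index s \<circ> Suc) \<beta> (Suc q) = (-1) ^ q * W (\<gamma> ?m)"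
    using s unfolding W_def \<rho>_def
    by (subst minor_move_row_to_front[of q])
       (auto simp: insert_index_def intro!: minor_cong split: nat.split)
  have D0: "minor K (\<gamma> \<circ> Suc) \<beta> ?m = D 0"
    unfolding D_def by (intro minor_cong) (auto simp: insert_index_def)
  have Dm: "minor K \<gamma> \<beta> ?m = D ?m"
    unfolding D_def by (intro minor_cong) (auto simp: insert_index_def)
  obtain s' where s': "s = Suc s'" using s by (cases s) auto
  show ?thesis
    using three unfolding E0 Es Em D0 Dm D_def[of s, symmetric] by (simp add: s' algebra_simps)
qed

text \<open>
  One half of Fekete's criterion. The columns are fixed, and the rows are filled in by induction on the
  order of the minor and then on the distance between the first and the last row. If the rows have a
  gap, a row \<open>\<alpha> i + 1\<close> in the gap is added to them. Dropping instead the first or the last of the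
  enlarged list of rows reduces the distance, and the three-term relation then recovers the
  minor with the added row dropped.
\<close>

lemma minor_pos_if_consecutive_rows_pos:
  assumes consec: "\<And>m a. m \<le> M \<Longrightarrow> minor K (\<lambda>i. a + i) \<beta> m > 0"
  shows "m \<le> M \<Longrightarrow> strict_mono_on {..<m} \<alpha> \<Longrightarrow> minor K \<alpha> \<beta> m > 0"
proof (induction m arbitrary: \<alpha>)
  case 0
  then show ?case using consec[of 0 0] by (simp add: minor_def)
next
  case (Suc l)
  note IH = Suc.IH
  note le = Suc.prems(1)
  from Suc.prems(2) show ?case
  proof (induction "\<alpha> l - \<alpha> 0" arbitrary: \<alpha> rule: less_induct)
    case less
    note mono = less.prems
    have mono': "\<alpha> i < \<alpha> j" if "i < j" "j < Suc l" for i j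
      using strict_mono_onD[OF mono, of i j] that by auto
    show ?case
    proof (cases "\<forall>i<l. \<alpha> (Suc i) = Suc (\<alpha> i)")
      case True
      have shift: "\<alpha> i = \<alpha> 0 + i" if "i < Suc l" for i
        using that by (induction i) (auto simp: True)
      have "minor K \<alpha> \<beta> (Suc l) = minor K (\<lambda>i. \<alpha> 0 + i) \<beta> (Suc l)"
        by (intro minor_cong shift refl)
      then show ?thesis using consec[OF le] by simp
    next
      case False
      then obtain i where i: "i < l" "\<alpha> (Suc i) \<noteq> Suc (\<alpha> i)" by blast
      with mono'[of i "Suc i"] have gap: "Suc (\<alpha> i) < \<alpha> (Suc i)" by auto
      from i obtain q where q: "l = Suc q" by (cases l) auto
      define s where "s = Suc i"
      define \<gamma> where "\<gamma> k = (if k < s then \<alpha> k else if k = s then Suc (\<alpha> i) else \<alpha> (k - 1))" for k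
      have step: "\<gamma> k < \<gamma> (Suc k)" if "k < Suc l" for k
      proof -
        consider "k < i" | "k = i" | "k = Suc i" | "k > Suc i" by linarith
        then show ?thesis
        proof cases
          case 1
          then show ?thesis using mono'[of k "Suc k"] i by (simp add: \<gamma>_def s_def)
        next
          case 4
          then show ?thesis using mono'[of "k - 1" k] that by (simp add: \<gamma>_def s_def)
        qed (use gap in \<open>simp_all add: \<gamma>_def s_def\<close>)
      qed
      have \<gamma>_mono: "\<gamma> j < \<gamma> k" if "j < k" "k \<le> Suc l" for j k
        using that
      proof (induction k)
        case (Suc k)
        then show ?case using step[of k] by (cases "j = k") (simp, fastforce)
      qed simp
      have ins_mono: "insert_index s j < insert_index s k" if "j < k" for j k
        using that by (auto simp: insert_index_def)
      have ins_le: "insert_index s k \<le> Suc k" for k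
        by (auto simp: insert_index_def)
      have D0: "minor K (\<gamma> \<circ> Suc) \<beta> (Suc l) > 0"
      proof (rule less.hyps)
        have "\<gamma> (Suc l) = \<alpha> l" "\<gamma> 0 = \<alpha> 0" using i by (auto simp: \<gamma>_def s_def)
        moreover have "\<gamma> 0 < \<gamma> (Suc 0)" "\<gamma> (Suc 0) \<le> \<gamma> (Suc l)"
          using \<gamma>_mono[of 0 1] \<gamma>_mono[of 1 "Suc l"] i by auto
        ultimately show "(\<gamma> \<circ> Suc) l - (\<gamma> \<circ> Suc) 0 < \<alpha> l - \<alpha> 0" by simp
      qed (auto intro!: strict_mono_onI \<gamma>_mono)
      have Dm: "minor K \<gamma> \<beta> (Suc l) > 0"
      proof (rule less.hyps)
        have "\<gamma> (Suc l) = \<alpha> l" "\<gamma> 0 = \<alpha> 0" using i by (auto simp: \<gamma>_def s_def)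
        moreover have "\<gamma> 0 < \<gamma> l" "\<gamma> l < \<gamma> (Suc l)"
          using \<gamma>_mono[of 0 l] \<gamma>_mono[of l "Suc l"] i by auto
        ultimately show "\<gamma> l - \<gamma> 0 < \<alpha> l - \<alpha> 0" by simp
      qed (auto intro!: strict_mono_onI \<gamma>_mono)
      have E0: "minor K (\<gamma> \<circ> insert_index s) \<beta> (Suc q) > 0"
        unfolding q[symmetric] using le
        by (intro IH strict_mono_onI) (auto intro!: \<gamma>_mono ins_mono ins_le[THEN order_trans])
      have Em: "minor K (\<gamma> \<circ> insert_index s \<circ> Suc) \<beta> (Suc q) > 0"
        unfolding q[symmetric] using le
        by (intro IH strict_mono_onI) (auto intro!: \<gamma>_mono ins_mono ins_le[THEN order_trans])
      have Es: "minor K (\<gamma> \<circ> Suc) \<beta> (Suc q) > 0"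
        unfolding q[symmetric] using le
        by (intro IH strict_mono_onI) (auto intro!: \<gamma>_mono)
      have "minor K (\<gamma> \<circ> insert_index s) \<beta> (Suc l) * minor K (\<gamma> \<circ> Suc) \<beta> (Suc q) > 0"
        using minor_three_term[of s q K \<gamma> \<beta>] D0 Dm E0 Em i
        by (simp add: q s_def add_pos_pos)
      then have "minor K (\<gamma> \<circ> insert_index s) \<beta> (Suc l) > 0"
        using Es by (simp add: zero_less_mult_iff)
      moreover have "\<gamma> \<circ> insert_index s = \<alpha>"
        by (auto simp: \<gamma>_def insert_index_def)
      ultimately show ?thesis by simp
    qed
  qed
qed

text \<open>
  Fekete's criterion. The previous lemma is applied twice: to the rows with consecutive columns, and
  then, after transposing, to the columns with the arbitrary rows obtained in the first step.
\<close>

lemma fekete: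
  assumes consec: "\<And>m a b. minor K (\<lambda>i. a + i) (\<lambda>j. b + j) m > 0"
    and "strict_mono_on {..<m} \<alpha>" "strict_mono_on {..<m} \<beta>"
  shows "minor K \<alpha> \<beta> m > 0"
proof -
  have "minor (\<lambda>i j. K j i) (\<lambda>j. b + j) \<alpha> k > 0" if "k \<le> m" for k b
    unfolding minor_transpose[of K]
  proof (rule minor_pos_if_consecutive_rows_pos[OF consec])
    show "strict_mono_on {..<k} \<alpha>"
      using assms(2) that by (auto simp: strict_mono_on_def)
  qed auto
  then have "minor (\<lambda>i j. K j i) \<beta> \<alpha> m > 0"
    by (rule minor_pos_if_consecutive_rows_pos) (use assms(3) in auto)
  then show ?thesis by (simp only: minor_transpose[of K])
qed

lemma minor_scale:
  "minor (\<lambda>i j. d i * e j * K i j) \<alpha> \<beta> m =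
     (\<Prod>i<m. d (\<alpha> i)) * (\<Prod>j<m. e (\<beta> j)) * minor K \<alpha> \<beta> m"
proof -
  have eq: "(\<Prod>i = 0..<m. d (\<alpha> i) * e (\<beta> (p i)) * K (\<alpha> i) (\<beta> (p i)))
      = (\<Prod>i<m. d (\<alpha> i)) * (\<Prod>j<m. e (\<beta> j)) * (\<Prod>i = 0..<m. K (\<alpha> i) (\<beta> (p i)))"
    if "p permutes {0..<m}" for p
  proof -
    have "(\<Prod>i = 0..<m. e (\<beta> (p i))) = (\<Prod>j = 0..<m. e (\<beta> j))"
      using prod.permute[OF that, of "\<lambda>j. e (\<beta> j)"] by (simp add: o_def)
    then show ?thesis by (simp add: prod.distrib atLeast0LessThan)
  qed
  have leibniz: "minor L \<alpha> \<beta> m = (\<Sum>p | p permutes {0..<m}. signof p * (\<Prod>i = 0..<m. L (\<alpha> i) (\<beta> (p i))))" for L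
    unfolding minor_def
    by (subst det_def'[where n = m])
       (auto intro!: sum.cong prod.cong simp: permutes_in_image)
  show ?thesis
    unfolding leibniz sum_distrib_left
  proof (intro sum.cong refl)
    fix p assume "p \<in> {p. p permutes {0..<m}}"
    then show "signof p * (\<Prod>i = 0..<m. d (\<alpha> i) * e (\<beta> (p i)) * K (\<alpha> i) (\<beta> (p i)))
      = (\<Prod>i<m. d (\<alpha> i)) * (\<Prod>j<m. e (\<beta> j)) * (signof p * (\<Prod>i = 0..<m. K (\<alpha> i) (\<beta> (p i))))"
      by (subst eq) auto
  qed
qed

section \<open>Positive definite Hankel matrices\<close>

definition hankel_psd :: "(nat \<Rightarrow> real) \<Rightarrow> bool" where
  "hankel_psd f \<longleftrightarrow> (\<forall>m x. 0 \<le> (\<Sum>i<m. \<Sum>j<m. x i * x j * f (i + j)))"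

definition hankel_pd :: "(nat \<Rightarrow> real) \<Rightarrow> bool" where
  "hankel_pd f \<longleftrightarrow>
     (\<forall>m x. (\<exists>i<m. x i \<noteq> 0) \<longrightarrow> 0 < (\<Sum>i<m. \<Sum>j<m. x i * x j * f (i + j)))"

lemma hankel_pd_imp_psd:
  assumes "hankel_pd f"
  shows "hankel_psd f"
  unfolding hankel_psd_def
proof (intro allI)
  fix m and x :: "nat \<Rightarrow> real"
  show "0 \<le> (\<Sum>i<m. \<Sum>j<m. x i * x j * f (i + j))"
  proof (cases "\<exists>i<m. x i \<noteq> 0")
    case True
    then show ?thesis using assms unfolding hankel_pd_def by (meson less_imp_le)
  next
    case False
    then show ?thesis by simp
  qed
qed

text \<open>
  Since \<open>b ^ (i + j) = b ^ i * b ^ j\<close>, the geometric factor is absorbed into the vector \<open>x\<close>.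
\<close>

lemma hankel_psd_geometric:
  assumes "hankel_psd f" "a \<ge> 0"
  shows "hankel_psd (\<lambda>n. a * b ^ n * f n)"
  unfolding hankel_psd_def
proof (intro allI)
  fix m and x :: "nat \<Rightarrow> real"
  have "(\<Sum>i<m. \<Sum>j<m. x i * x j * (a * b ^ (i + j) * f (i + j)))
      = a * (\<Sum>i<m. \<Sum>j<m. (x i * b ^ i) * (x j * b ^ j) * f (i + j))"
    by (simp add: sum_distrib_left power_add mult_ac)
  also have "\<dots> \<ge> 0"
    using assms(1)[unfolded hankel_psd_def, rule_format, where x = "\<lambda>i. x i * b ^ i" and m = m] assms(2)
    by (intro mult_nonneg_nonneg) auto
  finally show "0 \<le> (\<Sum>i<m. \<Sum>j<m. x i * x j * (a * b ^ (i + j) * f (i + j)))" .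
qed

lemma hankel_psd_limit:
  assumes "\<And>N. hankel_psd (F N)" and "\<And>n. (\<lambda>N. F N n) \<longlonglongrightarrow> f n"
  shows "hankel_psd f"
  unfolding hankel_psd_def
proof (intro allI)
  fix m and x :: "nat \<Rightarrow> real"
  have "(\<lambda>N. \<Sum>i<m. \<Sum>j<m. x i * x j * F N (i + j))
          \<longlonglongrightarrow> (\<Sum>i<m. \<Sum>j<m. x i * x j * f (i + j))"
    by (intro tendsto_sum tendsto_mult tendsto_const assms(2))
  then show "0 \<le> (\<Sum>i<m. \<Sum>j<m. x i * x j * f (i + j))"
    by (rule LIMSEQ_le_const) (use assms(1) in \<open>auto simp: hankel_psd_def\<close>)
qed

text \<open>
  The Gamma integral after the substitution of \<open>a * t\<close> for \<open>t\<close>. It exhibits \<open>a powr (- r)\<close> as a positive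
  superposition of the functions \<open>a \<mapsto> exp (- t) powr a\<close>, each of which is geometric in \<open>a\<close>.
\<close>

lemma powr_minus_has_integral:
  fixes a r :: real
  assumes a: "a > 0" and r: "r > 0"
  shows "((\<lambda>t. t powr (r - 1) * exp (- (a * t))) has_integral Gamma r * a powr (- r)) {0..}"
proof -
  let ?g = "\<lambda>t::real. indicator {0..} t * t powr (r - 1) / exp t"
  let ?h = "\<lambda>t::real. indicator {0..} t * (t powr (r - 1) * exp (- (a * t)))"
  have eq: "ennreal (?g (0 + a * t)) = ennreal (a powr (r - 1)) * ennreal (?h t)" for t
    using a by (auto simp: indicator_def powr_mult exp_minus field_simps zero_le_mult_iff
        simp flip: ennreal_mult')
  have "ennreal (Gamma r) = (\<integral>\<^sup>+t. ennreal (?g t) \<partial>lborel)"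
    using Gamma_conv_nn_integral_real[OF r] by simp
  also have "\<dots> = ennreal \<bar>a\<bar> * (\<integral>\<^sup>+t. ennreal (?g (0 + a * t)) \<partial>lborel)"
    using a by (intro nn_integral_real_affine) auto
  also have "\<dots> = ennreal a * (ennreal (a powr (r - 1)) * (\<integral>\<^sup>+t. ennreal (?h t) \<partial>lborel))"
    unfolding eq using a by (subst nn_integral_cmult) auto
  also have "\<dots> = ennreal (a powr r) * (\<integral>\<^sup>+t. ennreal (?h t) \<partial>lborel)"
    using a by (simp add: mult.assoc[symmetric] powr_mult_base flip: ennreal_mult')
  finally have "ennreal (a powr (- r)) * ennreal (Gamma r)
      = ennreal (a powr (- r)) * (ennreal (a powr r) * (\<integral>\<^sup>+t. ennreal (?h t) \<partial>lborel))"
    by simp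
  also have "\<dots> = (\<integral>\<^sup>+t. ennreal (?h t) \<partial>lborel)"
    using a by (simp add: mult.assoc[symmetric] powr_add[symmetric] flip: ennreal_mult')
  finally have "(\<integral>\<^sup>+t. ennreal (?h t) \<partial>lborel) = ennreal (Gamma r * a powr (- r))"
    using r by (metis Gamma_real_pos ennreal_mult' less_imp_le mult.commute)
  then have "(?h has_integral Gamma r * a powr (- r)) UNIV"
    using r by (intro nn_integral_has_integral) (auto simp: Gamma_real_pos less_imp_le)
  moreover have "?h = (\<lambda>t. if t \<in> {0..} then t powr (r - 1) * exp (- (a * t)) else 0)"
    by (auto simp: indicator_def)
  ultimately show ?thesis
    by (simp only: has_integral_restrict_UNIV)
qed

text \<open>
  This is the step that produces strict positivity. Written with the preceding integral, the quadratic
  form is the integral over \<open>t > 0\<close> of a positive weight times the form of \<open>f (i + j)\<close> at the vector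
  \<open>x i * exp (- t) ^ i\<close>, which is nonnegative for every \<open>t\<close>. If the integral were zero, then so would be
  this form for all \<open>t\<close> in an interval. But it is a polynomial \<open>p\<close> in \<open>exp (- t)\<close>, whose lowest
  nonzero coefficient is \<open>(x k)\<^sup>2 * f (2 * k)\<close> for the first \<open>k\<close> with \<open>x k \<noteq> 0\<close>, a positive number.
\<close>

lemma hankel_pd_powr_mult:
  assumes f: "hankel_psd f" and pos: "\<And>n. f n > 0" and c: "c > 0" and r: "r > 0"
  shows "hankel_pd (\<lambda>n. (real n + c) powr (- r) * f n)"
  unfolding hankel_pd_def
proof (intro allI impI)
  fix m and x :: "nat \<Rightarrow> real"
  assume "\<exists>i<m. x i \<noteq> 0"
  then obtain k where k: "k < m" "x k \<noteq> 0" and k_min: "\<And>i. i < k \<Longrightarrow> x i = 0"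
    using exists_least_iff[of "\<lambda>i. i < m \<and> x i \<noteq> 0"] by (metis less_trans)
  let ?S = "\<Sum>i<m. \<Sum>j<m. x i * x j * ((real (i + j) + c) powr (- r) * f (i + j))"
  define p :: "real poly" where
    "p = (\<Sum>i<m. \<Sum>j<m. monom (x i * x j * f (i + j)) (i + j))"
  define h where "h t = t powr (r - 1) * exp (- (c * t)) * poly p (exp (- t))" for t :: real
  have p_eq: "poly p (exp (- t)) = (\<Sum>i<m. \<Sum>j<m. x i * x j * (exp (- t) ^ (i + j) * f (i + j)))" for t
    by (simp add: p_def poly_sum poly_monom mult_ac)
  have p_nonneg: "poly p (exp (- t)) \<ge> 0" for t
    using hankel_psd_geometric[OF f, of 1 "exp (- t)"]
    unfolding p_eq hankel_psd_def by simp
  have h_nonneg: "h t \<ge> 0" for t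
    using p_nonneg[of t] by (simp add: h_def)
  have "((\<lambda>t. \<Sum>i<m. \<Sum>j<m. x i * x j * f (i + j) *
            (t powr (r - 1) * exp (- ((real (i + j) + c) * t))))
          has_integral (\<Sum>i<m. \<Sum>j<m. x i * x j * f (i + j) *
            (Gamma r * (real (i + j) + c) powr (- r)))) {0..}"
    using c r
    by (intro has_integral_sum has_integral_mult_right powr_minus_has_integral) auto
  moreover have "(\<lambda>t. \<Sum>i<m. \<Sum>j<m. x i * x j * f (i + j) *
            (t powr (r - 1) * exp (- ((real (i + j) + c) * t)))) = h"
    unfolding h_def p_eq sum_distrib_left
    by (intro ext sum.cong refl)
       (simp add: exp_of_nat_mult[symmetric] exp_add[symmetric] algebra_simps)
  moreover have "(\<Sum>i<m. \<Sum>j<m. x i * x j * f (i + j) *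
            (Gamma r * (real (i + j) + c) powr (- r))) = Gamma r * ?S"
    by (simp add: sum_distrib_left mult_ac)
  ultimately have int: "(h has_integral Gamma r * ?S) {0..}" by simp
  have cont: "continuous_on {1..2} h"
    unfolding h_def by (intro continuous_intros) auto
  show "0 < ?S"
  proof (rule ccontr)
    assume "\<not> 0 < ?S"
    then have "Gamma r * ?S \<le> 0"
      using Gamma_real_pos[OF r] by (simp add: mult_nonneg_nonpos)
    moreover have int12: "(h has_integral integral {1..2} h) {1..2}"
      using cont by (intro integrable_integral integrable_continuous_real)
    then have "integral {1..2} h \<le> Gamma r * ?S"
      by (rule has_integral_subset_le[rotated, OF _ int]) (auto intro: h_nonneg)
    moreover have "integral {1..2} h \<ge> 0"
      using int12 h_nonneg by (rule has_integral_nonneg)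
    ultimately have "integral {1..2} h = 0" by linarith
    then have "\<forall>t\<in>{1..2}. h t = 0"
      using integral_eq_0_iff[OF cont] h_nonneg by simp
    then have "poly p (exp (- t)) = 0" if "t \<in> {1..2}" for t
      using that by (force simp: h_def)
    then have "(\<lambda>t. exp (- t)) ` {1..2} \<subseteq> {z. poly p z = 0}" by auto
    moreover have "infinite ((\<lambda>t::real. exp (- t)) ` {1..2})"
      by (subst finite_image_iff) (auto simp: inj_on_def infinite_Icc)
    ultimately have "p = 0"
      using poly_roots_finite finite_subset by blast
    then have "0 = coeff p (2 * k)" by simp
    also have "\<dots> = (\<Sum>i<m. \<Sum>j<m. if i = k \<and> j = k then x k * x k * f (2 * k) else 0)"
      unfolding p_def coeff_sum coeff_monom
    proof (intro sum.cong refl)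
      fix i j
      show "(if i + j = 2 * k then x i * x j * f (i + j) else 0)
          = (if i = k \<and> j = k then x k * x k * f (2 * k) else 0)"
        using k_min[of i] k_min[of j] by (cases "i < k"; cases "j < k") (auto simp: mult_2)
    qed
    also have "\<dots> = (\<Sum>i<m. if i = k then x k * x k * f (2 * k) else 0)"
      using k by (intro sum.cong refl) (auto simp: sum.delta)
    also have "\<dots> = x k * x k * f (2 * k)"
      using k by (simp add: sum.delta)
    finally show False using k pos[of "2 * k"] by simp
  qed
qed

lemma hankel_psd_pochhammer_powr:
  assumes c: "c > 0" and r: "r > 0"
  shows "hankel_psd (\<lambda>n. pochhammer (real n + c) N powr (- r))"
proof (induction N)
  case 0
  have "(\<Sum>i<m. \<Sum>j<m. x i * x j) = (\<Sum>i<m. x i)\<^sup>2" for m and x :: "nat \<Rightarrow> real"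
    by (simp add: power2_eq_square sum_product)
  then show ?case by (simp add: hankel_psd_def)
next
  case (Suc N)
  have "pochhammer (real n + c) N > 0" for n
    using c by (intro pochhammer_pos) auto
  then have "hankel_pd (\<lambda>n. (real n + (c + real N)) powr (- r) * pochhammer (real n + c) N powr (- r))"
    using Suc c r by (intro hankel_pd_powr_mult) (auto simp: less_imp_neq[THEN not_sym])
  moreover have "(real n + (c + real N)) powr (- r) * pochhammer (real n + c) N powr (- r)
      = pochhammer (real n + c) (Suc N) powr (- r)" for n
    using c by (subst powr_mult[symmetric])
       (auto simp: pochhammer_Suc mult_ac add_ac intro!: pochhammer_nonneg)
  ultimately show ?case by (simp add: hankel_pd_imp_psd)
qed

text \<open>
  Gauss's product writes Gamma as the limit of \<open>fact N * N powr z / pochhammer z (N + 1)\<close>; the numerator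
  is geometric in \<open>z\<close>, and the denominator is a product of linear factors. A limit only gives
  semidefiniteness.
\<close>

lemma hankel_psd_Gamma_powr:
  assumes c: "c > 0" and r: "r > 0"
  shows "hankel_psd (\<lambda>n. Gamma (real n + c) powr r)"
proof (rule hankel_psd_limit)
  fix n
  have "Gamma (real n + c) > 0" using c by (intro Gamma_real_pos) auto
  then show "(\<lambda>N. Gamma_series (real n + c) N powr r) \<longlonglongrightarrow> Gamma (real n + c) powr r"
    by (intro tendsto_powr Gamma_series_LIMSEQ tendsto_const) auto
next
  fix N :: nat
  have "Gamma_series (real n + c) N powr r
      = (fact N powr r * exp (c * r * ln (real N))) * exp (r * ln (real N)) ^ n *
        pochhammer (real n + c) (Suc N) powr (- r)" for n
  proof -
    have p: "pochhammer (real n + c) (Suc N) > 0"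
      using c by (intro pochhammer_pos) auto
    have "Gamma_series (real n + c) N powr r
       = fact N powr r * exp ((real n + c) * ln (real N)) powr r / pochhammer (real n + c) (Suc N) powr r"
      using p unfolding Gamma_series_def
      by (simp add: powr_divide powr_mult del: pochhammer_Suc)
    also have "exp ((real n + c) * ln (real N)) powr r
       = exp (c * r * ln (real N)) * exp (r * ln (real N)) ^ n"
      by (simp add: powr_def exp_of_nat_mult[symmetric] exp_add[symmetric] algebra_simps)
    finally show ?thesis by (simp add: powr_minus divide_inverse mult_ac)
  qed
  then show "hankel_psd (\<lambda>n. Gamma_series (real n + c) N powr r)"
    using hankel_psd_geometric[OF hankel_psd_pochhammer_powr[OF c r]] by simp
qed

text \<open>
  Strictness is recovered by splitting off one factor with the functional equation:
  \<open>Gamma z powr r = z powr (- r) * Gamma (z + 1) powr r\<close>.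
\<close>

lemma hankel_pd_Gamma_powr:
  assumes c: "c > 0" and r: "r > 0"
  shows "hankel_pd (\<lambda>n. Gamma (real n + c) powr r)"
proof -
  have pos: "Gamma (real n + (c + 1)) > 0" for n
    using c by (intro Gamma_real_pos) auto
  have "hankel_pd (\<lambda>n. (real n + c) powr (- r) * Gamma (real n + (c + 1)) powr r)"
  proof (rule hankel_pd_powr_mult)
    show "Gamma (real n + (c + 1)) powr r > 0" for n
      using pos[of n] by simp
  qed (use c r hankel_psd_Gamma_powr[of "c + 1" r] in auto)
  moreover have "(real n + c) powr (- r) * Gamma (real n + (c + 1)) powr r
      = Gamma (real n + c) powr r" for n
  proof -
    have "real n + c > 0" "Gamma (real n + c) > 0"
      using c by (auto intro!: Gamma_real_pos)
    moreover have "Gamma (real n + (c + 1)) = (real n + c) * Gamma (real n + c)"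
      using Gamma_plus1[of "real n + c"] \<open>real n + c > 0\<close> nonpos_Ints_nonpos[of "real n + c"]
      by (auto simp: add.assoc)
    ultimately show ?thesis
      by (simp add: powr_mult powr_minus)
  qed
  ultimately show ?thesis by simp
qed

text \<open>
  The segment from the identity matrix to the given matrix consists of positive definite, hence
  nonsingular, matrices; the determinant is continuous along it and starts at \<open>1\<close>.
\<close>

lemma det_pos_if_positive_definite:
  fixes K :: "nat \<Rightarrow> nat \<Rightarrow> real"
  assumes pd: "\<And>x. \<exists>i<m. x i \<noteq> 0 \<Longrightarrow> 0 < (\<Sum>i<m. \<Sum>j<m. x i * x j * K i j)"
  shows "Determinant.det (mat m m (\<lambda>(i, j). K i j)) > 0"
proof -
  define B where "B t = mat m m (\<lambda>(i, j). t * K i j + (1 - t) * (if i = j then 1 else 0))" for t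
  define d where "d t = Determinant.det (B t)" for t
  have B: "B t \<in> carrier_mat m m" for t by (simp add: B_def)
  have d_ne: "d t \<noteq> 0" if t: "0 \<le> t" "t \<le> 1" for t
  proof
    assume "d t = 0"
    then obtain v where v: "v \<in> carrier_vec m" "v \<noteq> 0\<^sub>v m" and Bv: "B t *\<^sub>v v = 0\<^sub>v m"
      using det_0_iff_vec_prod_zero[OF B] unfolding d_def by blast
    define x where "x i = vec_index v i" for i
    have ex: "\<exists>i<m. x i \<noteq> 0"
      using v unfolding x_def by (metis carrier_vecD eq_vecI index_zero_vec(1,2))
    have "0 = (\<Sum>i<m. x i * vec_index (B t *\<^sub>v v) i)"
      by (simp add: Bv)
    also have "\<dots> = (\<Sum>i<m. \<Sum>j<m. x i * x j * (t * K i j + (1 - t) * (if i = j then 1 else 0)))"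
      using v(1)
      by (intro sum.cong refl)
         (auto simp: B_def x_def scalar_prod_def sum_distrib_left atLeast0LessThan mult_ac intro!: sum.cong)
    also have "\<dots> = t * (\<Sum>i<m. \<Sum>j<m. x i * x j * K i j)
        + (1 - t) * (\<Sum>i<m. \<Sum>j<m. if i = j then x i * x j else 0)"
      unfolding sum_distrib_left sum.distrib[symmetric]
      by (intro sum.cong refl) (auto simp: algebra_simps)
    also have "(\<Sum>i<m. \<Sum>j<m. if i = j then x i * x j else 0) = (\<Sum>i<m. (x i)\<^sup>2)"
      by (intro sum.cong refl) (auto simp: sum.delta power2_eq_square)
    finally have zero: "t * (\<Sum>i<m. \<Sum>j<m. x i * x j * K i j) + (1 - t) * (\<Sum>i<m. (x i)\<^sup>2) = 0"
      by simp
    have "0 < (\<Sum>i<m. \<Sum>j<m. x i * x j * K i j)" by (rule pd[OF ex])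
    moreover have "0 < (\<Sum>i<m. (x i)\<^sup>2)"
      using ex by (auto intro!: sum_pos2)
    ultimately have "t * (\<Sum>i<m. \<Sum>j<m. x i * x j * K i j) + (1 - t) * (\<Sum>i<m. (x i)\<^sup>2) > 0"
      using t by (cases "t = 0") (auto intro!: add_pos_nonneg)
    with zero show False by simp
  qed
  have "d t = (\<Sum>p | p permutes {0..<m}. signof p *
      (\<Prod>i = 0..<m. t * K i (p i) + (1 - t) * (if i = p i then 1 else 0)))" for t
    unfolding d_def det_def'[OF B]
    by (intro sum.cong refl arg_cong2[where f = "(*)"] prod.cong)
       (auto simp: B_def permutes_in_image)
  then have "continuous_on {0..1} d"
    by (subst continuous_on_cong[OF refl]) (auto intro!: continuous_intros)
  moreover have "B 0 = 1\<^sub>m m" by (auto simp: B_def)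
  then have "d 0 = 1" by (simp add: d_def)
  moreover have "B 1 = mat m m (\<lambda>(i, j). K i j)" by (auto simp: B_def)
  ultimately show ?thesis
    using IVT2'[of d 1 0 0] d_ne unfolding d_def
    by (metis atLeastAtMost_iff linorder_not_le order.refl zero_le_one)
qed

section \<open>Total positivity\<close>

lemma totally_positive_if_minors_pos:
  assumes "\<And>m \<alpha> \<beta>. strict_mono_on {..<m} \<alpha> \<Longrightarrow> strict_mono_on {..<m} \<beta> \<Longrightarrow> minor K \<alpha> \<beta> m > 0"
  shows "totally_positive (mat n n (\<lambda>(i, j). K i j))"
  unfolding totally_positive_def
proof (intro allI impI, elim conjE)
  fix I J
  let ?A = "mat n n (\<lambda>(i, j). K i j)"
  assume "I \<subseteq> {..<dim_row ?A}" "J \<subseteq> {..<dim_col ?A}" and card: "card I = card J"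
  then have I: "I \<subseteq> {..<n}" and J: "J \<subseteq> {..<n}" by auto
  have restrict: "{i. i < n \<and> i \<in> I} = I" "{j. j < n \<and> j \<in> J} = J"
    using I J by auto
  have pick_less: "pick I i < n" "pick J i < n" if "i < card I" for i
    using that I J pick_in_set_le[of i I] pick_in_set_le[of i J] card by auto
  have "submatrix ?A I J = mat (card I) (card I) (\<lambda>(i, j). K (pick I i) (pick J j))"
    using restrict card pick_less by (intro eq_matI) (auto simp: submatrix_def)
  then have "Determinant.det (submatrix ?A I J) = minor K (pick I) (pick J) (card I)"
    by (simp add: minor_def)
  also have "\<dots> > 0"
    using card by (intro assms strict_mono_onI) (auto intro: pick_mono_le)
  finally show "Determinant.det (submatrix ?A I J) > 0" .
qed

lemma inverse_Beta_powr:
  "(1 / Beta (real (i + 1)) (real (j + 1))) powr r =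
     Gamma (real i + 1) powr (- r) * Gamma (real j + 1) powr (- r) * Gamma (real (i + j) + 2) powr r"
proof -
  have pos: "Gamma (real i + 1) > 0" "Gamma (real j + 1) > 0" "Gamma (real (i + j) + 2) > 0"
    by (auto intro!: Gamma_real_pos)
  have "1 / Beta (real (i + 1)) (real (j + 1))
      = Gamma (real (i + j) + 2) / (Gamma (real i + 1) * Gamma (real j + 1))"
    using pos by (simp add: Beta_def add_ac)
  then show ?thesis
    using pos by (simp add: powr_divide powr_mult powr_minus field_simps)
qed

theorem mainTheorem2:
  fixes n :: nat and r :: real
  assumes "n \<ge> 1" and "r > 0"
  shows "totally_positive (hadamard_power (beta_mat n) r)"
proof -
  define K where "K i j = (1 / Beta (real (i + 1)) (real (j + 1))) powr r" for i j
  define H where "H i j = Gamma (real (i + j) + 2) powr r" for i j :: nat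
  define d where "d i = Gamma (real i + 1) powr (- r)" for i :: nat
  have K_eq: "K = (\<lambda>i j. d i * d j * H i j)"
    unfolding K_def H_def d_def inverse_Beta_powr ..
  have d_pos: "d i > 0" for i
  proof -
    have "Gamma (real i + 1) > 0" by (intro Gamma_real_pos) auto
    then show ?thesis unfolding d_def powr_gt_zero by (rule less_imp_neq[THEN not_sym])
  qed
  have consecutive: "minor K (\<lambda>i. a + i) (\<lambda>j. b + j) m > 0" for a b m
  proof -
    have "hankel_pd (\<lambda>k. Gamma (real k + (real a + real b + 2)) powr r)"
      using assms by (intro hankel_pd_Gamma_powr) auto
    then have "minor H (\<lambda>i. a + i) (\<lambda>j. b + j) m > 0"
      unfolding minor_def H_def hankel_pd_def
      by (intro det_pos_if_positive_definite) (simp add: add_ac)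
    then show ?thesis
      unfolding K_eq minor_scale by (intro mult_pos_pos prod_pos d_pos) auto
  qed
  have "hadamard_power (beta_mat n) r = mat n n (\<lambda>(i, j). K i j)"
    unfolding hadamard_power_def beta_mat_def K_def by (intro eq_matI) auto
  then show ?thesis
    using totally_positive_if_minors_pos[OF fekete[OF consecutive]] by simp
qed

end
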